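(* Suppose $n=k(m+1)$ for some positive integers $k,m$, and let $p(x)=x^n+c_{n-1}x^{n-1}+\cdots+c_1x+c_0$ with $c_0=1$ and $c_1,\ldots,c_{n-1}\in\mathbb{R}$. There exists a striped companion matrix $S=S_n(k,\ldots,k)$ (with $m+1$ stripes of length $k$) for $p(x)$ such that $\kappa(S)\le\kappa(F)$ for every Fiedler companion matrix $F$ to $p(x)$ if and only if $$\sum_{j=1}^m\left(\sum_{i=1}^{k-1}|c_ic_{jk}-c_{jk+i}|^2\right)\le\sum_{j=1}^m\left(\sum_{i=1}^{k-1}|c_{jk+i}|^2\right).$$
   Context: For a real $n\times n$ matrix $A=[a_{i,j}]$, $\|A\|=\sqrt{\sum_{i,j}a_{i,j}^2}$ is the Frobenius norm, and for invertible $A$, $\kappa(A)=\|A\|\cdot\|A^{-1}\|$. Two matrices are called equivalent if one is obtained from the other by transposition and/or permutation similarity. Fiedler companion matrices: let $F_0=\mathrm{diag}(1,\ldots,1,-c_0)$ and, for $1\le k\le n-1$, let $F_k$ be the block diagonal matrix with diagonal blocks $I_{n-k-1}$, $\begin{bmatrix}-c_k&1\\1&0\end{bmatrix}$, $I_{k-1}$ (in this order). A Fiedler companion matrix to $p(x)$ is a matrix equal (or equivalent) to a product $F_{\sigma_0}F_{\sigma_1}\cdots F_{\sigma_{n-1}}$ for some permutation $(\sigma_0,\ldots,\sigma_{n-1})$ of $\{0,1,\ldots,n-1\}$. Striped companion matrices: let $\mathbf{t}=(t_1,\ldots,t_r)$ be positive integers with $t_1+\cdots+t_r=n$ and $t_1\ge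 t_i$ for all $i$. The striped companion matrix $S_n(\mathbf{t})$ to $p(x)$ is the $n\times n$ matrix with $1$ in every position $(i,i+1)$, $1\le i\le n-1$, whose remaining nonzero entries lie in the $(n-t_1+1)\times t_1$ submatrix $R$ formed by rows $t_1,\ldots,n$ and columns $1,\ldots,t_1$. The matrix $R$ has $r$ designated rows (stripes): the first is row $1$ of $R$, and for $1<i\le r$ the $i$-th is preceded immediately by $t_i-1$ zero rows of $R$ (so the $i$-th stripe lies in row $t_1+\cdots+t_i$ of $S_n(\mathbf{t})$). The $i$-th stripe has coefficient entries in its first $t_i$ positions and zeros elsewhere; a coefficient entry in position $(p,q)$ of $S_n(\mathbf{t})$ equals $-c_{n-1-(p-q)}$. In particular, for $\mathbf{t}=(k,\ldots,k)$ with $n=k(m+1)$, row $n-jk$ of $S_n(k,\ldots,k)$ has first $k$ entries $-c_{jk},-c_{jk+1},\ldots,-c_{jk+k-1}$ for $j=0,1,\ldots,m$. *)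

theory Defs
  imports
    Complex_Main
    "HOL-Combinatorics.Permutations"
    "HOL-Computational_Algebra.Polynomial"
    "Jordan_Normal_Form.Gauss_Jordan_Elimination"
begin

definition frobenius_norm :: "real mat \<Rightarrow> real" where
  "frobenius_norm A = sqrt (\<Sum>i<dim_row A. \<Sum>j<dim_col A. (A $$ (i, j))\<^sup>2)"

text \<open>Meaningful for invertible matrices only: on a singular matrix \<^term>\<open>mat_inverse\<close>
  returns \<^term>\<open>None\<close> and the value is unspecified.\<close>

definition condition_number :: "real mat \<Rightarrow> real" where
  "condition_number A = frobenius_norm A * frobenius_norm (the (mat_inverse A))"

definition perm_matrix :: "nat \<Rightarrow> (nat \<Rightarrow> nat) \<Rightarrow> real mat" where
  "perm_matrix n \<pi> = mat n n (\<lambda>(i, j). if j = \<pi> i then 1 else 0)"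

definition permutation_similar :: "real mat \<Rightarrow> real mat \<Rightarrow> bool" where
  "permutation_similar A B \<longleftrightarrow>
     (\<exists>\<pi>. \<pi> permutes {..<dim_row A} \<and>
        B = perm_matrix (dim_row A) \<pi> * A * transpose_mat (perm_matrix (dim_row A) \<pi>))"

text \<open>Taking \<open>\<pi> = id\<close> shows that this covers equality and transposition on its own.\<close>

definition matrix_equivalent :: "real mat \<Rightarrow> real mat \<Rightarrow> bool" where
  "matrix_equivalent A B \<longleftrightarrow>
     permutation_similar A B \<or> permutation_similar (transpose_mat A) B"

text \<open>For a monic polynomial \<open>p\<close>, \<open>n = degree p\<close> and \<open>c\<^sub>k = coeff p k\<close>.
  The matrix \<open>F\<^sub>k\<close> is meant for \<open>k < n\<close>.\<close>

definition fiedler_factor :: "real poly \<Rightarrow> nat \<Rightarrow> real mat" where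
  "fiedler_factor p k =
     (let n = degree p in
      if k = 0 then mat_diag n (\<lambda>i. if i = n - 1 then - coeff p 0 else 1)
      else diag_block_mat
        [1\<^sub>m (n - k - 1),
         mat_of_rows_list 2 [[- coeff p k, 1], [1, 0]],
         1\<^sub>m (k - 1)])"

definition fiedler_product :: "real poly \<Rightarrow> (nat \<Rightarrow> nat) \<Rightarrow> real mat" where
  "fiedler_product p \<sigma> =
     foldr (\<lambda>i M. fiedler_factor p (\<sigma> i) * M) [0..<degree p] (1\<^sub>m (degree p))"

definition fiedler_companion :: "real poly \<Rightarrow> real mat \<Rightarrow> bool" where
  "fiedler_companion p F \<longleftrightarrow>
     (\<exists>\<sigma>. \<sigma> permutes {..<degree p} \<and> matrix_equivalent (fiedler_product p \<sigma>) F)"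

text \<open>Indices of \<^term>\<open>mat\<close> start at 0, so the stripe number \<open>l\<close> (from 0) lies in the row
  \<open>i\<close> with \<open>i + 1 = t\<^sub>1 + \<dots> + t\<^bsub>l+1\<^esub>\<close> and occupies the columns \<open>j < t\<^bsub>l+1\<^esub>\<close>. On a stripe
  \<open>j \<le> i\<close> if \<open>t\<^sub>1\<close> is maximal, so the subtractions are not truncated.\<close>

definition striped_matrix :: "real poly \<Rightarrow> nat list \<Rightarrow> real mat" where
  "striped_matrix p ts =
     mat (degree p) (degree p) (\<lambda>(i, j).
       if j = i + 1 then 1
       else if \<exists>l<length ts. i + 1 = sum_list (take (l + 1) ts) \<and> j < ts ! l
         then - coeff p (degree p - 1 - (i - j))
       else 0)"

definition striped_companion :: "real poly \<Rightarrow> nat list \<Rightarrow> real mat \<Rightarrow> bool" where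
  "striped_companion p ts S \<longleftrightarrow>
     ts \<noteq> [] \<and> (\<forall>t\<in>set ts. 0 < t \<and> t \<le> hd ts) \<and> sum_list ts = degree p \<and>
     S = striped_matrix p ts"

end

theory Submission
  imports Defs "Jordan_Normal_Form.Determinant"
begin

text \<open>For \<open>c\<^sub>0 = 1\<close> every Fiedler companion matrix \<open>F\<close> satisfies
  \<open>\<parallel>F\<parallel>\<^sup>2 = \<parallel>F\<^sup>-\<^sup>1\<parallel>\<^sup>2 = n + c\<^sub>1\<^sup>2 + \<dots> + c\<^sub>n\<^sub>-\<^sub>1\<^sup>2\<close>: the factor of largest index can be moved to one
  end of the product, and multiplying by it changes only two rows or columns, so that the norm can be
  followed by induction. The striped matrix \<open>S\<close> has the same norm as \<open>F\<close>, and its inverse is found by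
  solving \<open>S x = y\<close>; comparing \<open>\<parallel>S\<^sup>-\<^sup>1\<parallel>\<close> with \<open>\<parallel>F\<^sup>-\<^sup>1\<parallel>\<close> gives the inequality.\<close>

section \<open>Frobenius norm and condition number\<close>

text \<open>Single rows are tracked because multiplication by a Fiedler factor changes only two of
  them; columns are rows of the transpose.\<close>

definition row_norm_sq :: "real mat \<Rightarrow> nat \<Rightarrow> real" where
  "row_norm_sq A i = (\<Sum>j<dim_col A. (A $$ (i, j))\<^sup>2)"

definition norm_sq :: "real mat \<Rightarrow> real" where
  "norm_sq A = (\<Sum>i<dim_row A. row_norm_sq A i)"

lemma frobenius_norm_eq_sqrt: "frobenius_norm A = sqrt (norm_sq A)"
  by (simp add: frobenius_norm_def norm_sq_def row_norm_sq_def)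

lemma norm_sq_nonneg: "0 \<le> norm_sq A"
  by (simp add: norm_sq_def row_norm_sq_def sum_nonneg)

lemma norm_sq_transpose: "norm_sq (transpose_mat A) = norm_sq A"
proof -
  have "norm_sq (transpose_mat A) = (\<Sum>i<dim_col A. \<Sum>j<dim_row A. (A $$ (j, i))\<^sup>2)"
    by (simp add: norm_sq_def row_norm_sq_def)
  also have "\<dots> = norm_sq A"
    by (simp add: norm_sq_def row_norm_sq_def sum.swap[of _ "{..<dim_col A}"])
  finally show ?thesis .
qed

text \<open>A one-sided inverse of a square matrix over a field is two-sided, so \<open>A\<close> is
  a unit and \<open>mat_inverse A\<close> cannot be \<open>None\<close>; uniqueness of inverses does
  the rest.\<close>

lemma mat_inverse_eqI:
  fixes A B :: "'a :: field mat"
  assumes "A \<in> carrier_mat n n" "B \<in> carrier_mat n n" "A * B = 1\<^sub>m n"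
  shows "mat_inverse A = Some B"
proof (cases "mat_inverse A")
  case None
  have "B * A = 1\<^sub>m n"
    using mat_mult_left_right_inverse assms by blast
  then have "A \<in> Units (ring_mat TYPE('a) n ())"
    using assms unfolding Units_def by (auto simp: ring_mat_def)
  with mat_inverse(1)[OF assms(1) None, of "()"] show ?thesis by simp
next
  case (Some C)
  have C: "C * A = 1\<^sub>m n" "C \<in> carrier_mat n n"
    using mat_inverse(2)[OF assms(1) Some] by auto
  have "C = C * (A * B)" using assms C by simp
  also have "\<dots> = B" using assoc_mult_mat[OF C(2) assms(1,2)] assms(2) C(1) by simp
  finally show ?thesis using Some by simp
qed

lemma condition_number_eq:
  assumes "A \<in> carrier_mat n n" "B \<in> carrier_mat n n" "A * B = 1\<^sub>m n"
  shows "condition_number A = sqrt (norm_sq A) * sqrt (norm_sq B)"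
  by (simp add: condition_number_def frobenius_norm_eq_sqrt mat_inverse_eqI[OF assms])

lemma mult_mat_entry:
  assumes "A \<in> carrier_mat n m" "B \<in> carrier_mat m l" "i < n" "j < l"
  shows "(A * B) $$ (i, j) = (\<Sum>t<m. A $$ (i, t) * B $$ (t, j))"
  using assms by (simp add: scalar_prod_def lessThan_atLeast0)

section \<open>Invariance of the condition number under equivalence\<close>

definition reindex_mat :: "(nat \<Rightarrow> nat) \<Rightarrow> 'a mat \<Rightarrow> 'a mat" where
  "reindex_mat \<pi> A = mat (dim_row A) (dim_col A) (\<lambda>(i, j). A $$ (\<pi> i, \<pi> j))"

text \<open>Row \<open>i\<close> of the permutation matrix has its only 1 in column
  \<open>\<pi> i\<close>, so the left factor selects row \<open>\<pi> i\<close> and the transposed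
  right factor selects column \<open>\<pi> j\<close>.\<close>

lemma perm_matrix_conj:
  assumes A: "A \<in> carrier_mat n n" and \<pi>: "\<pi> permutes {..<n}"
  shows "perm_matrix n \<pi> * A * transpose_mat (perm_matrix n \<pi>) = reindex_mat \<pi> A"
proof (rule eq_matI)
  fix i j assume "i < dim_row (reindex_mat \<pi> A)" "j < dim_col (reindex_mat \<pi> A)"
  with A have ij: "i < n" "j < n" by (auto simp: reindex_mat_def)
  have P: "perm_matrix n \<pi> \<in> carrier_mat n n" by (simp add: perm_matrix_def)
  then have PT: "transpose_mat (perm_matrix n \<pi>) \<in> carrier_mat n n" by simp
  have PTe: "transpose_mat (perm_matrix n \<pi>) $$ (t, j) = (if t = \<pi> j then 1 else 0)" if "t < n" for t
    using ij that by (simp add: perm_matrix_def)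
  have lt: "\<pi> i < n" if "i < n" for i using permutes_in_image[OF \<pi>] that by blast
  have PA: "(perm_matrix n \<pi> * A) $$ (i, t) = A $$ (\<pi> i, t)" if "t < n" for t
  proof -
    have "(perm_matrix n \<pi> * A) $$ (i, t) = (\<Sum>s<n. if s = \<pi> i then A $$ (s, t) else 0)"
      unfolding mult_mat_entry[OF P A ij(1) that] using ij by (intro sum.cong) (auto simp: perm_matrix_def)
    then show ?thesis using lt[OF ij(1)] by simp
  qed
  have "(perm_matrix n \<pi> * A * transpose_mat (perm_matrix n \<pi>)) $$ (i, j)
      = (\<Sum>t<n. A $$ (\<pi> i, t) * (if t = \<pi> j then 1 else 0))"
    unfolding mult_mat_entry[OF mult_carrier_mat[OF P A] PT ij]
    by (intro sum.cong refl) (simp only: PA PTe lessThan_iff)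
  also have "\<dots> = A $$ (\<pi> i, \<pi> j)"
    using lt[OF ij(2)] by (simp add: if_distrib cong: if_cong)
  finally show "(perm_matrix n \<pi> * A * transpose_mat (perm_matrix n \<pi>)) $$ (i, j) =
      reindex_mat \<pi> A $$ (i, j)"
    using ij A by (simp add: reindex_mat_def)
qed (use A in \<open>auto simp: perm_matrix_def reindex_mat_def\<close>)

lemma norm_sq_reindex:
  assumes A: "A \<in> carrier_mat n n" and \<pi>: "\<pi> permutes {..<n}"
  shows "norm_sq (reindex_mat \<pi> A) = norm_sq A"
proof -
  have "norm_sq (reindex_mat \<pi> A) = (\<Sum>i<n. \<Sum>j<n. (A $$ (\<pi> i, \<pi> j))\<^sup>2)"
    using A by (simp add: norm_sq_def row_norm_sq_def reindex_mat_def)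
  also have "\<dots> = (\<Sum>i<n. \<Sum>j<n. (A $$ (\<pi> i, j))\<^sup>2)"
    by (simp add: sum.permute[OF \<pi>, of "\<lambda>j. (A $$ (_, j))\<^sup>2"] o_def)
  also have "\<dots> = (\<Sum>i<n. \<Sum>j<n. (A $$ (i, j))\<^sup>2)"
    by (simp add: sum.permute[OF \<pi>, of "\<lambda>i. \<Sum>j<n. (A $$ (i, j))\<^sup>2"] o_def)
  also have "\<dots> = norm_sq A"
    using A by (simp add: norm_sq_def row_norm_sq_def)
  finally show ?thesis .
qed

text \<open>The inner summation index can be permuted along, which leaves an entry of
  \<open>A * B\<close>; injectivity of \<open>\<pi>\<close> preserves the identity matrix.\<close>

lemma reindex_mat_inverse:
  fixes A B :: "'a :: semiring_1 mat"
  assumes AB: "A \<in> carrier_mat n n" "B \<in> carrier_mat n n" "A * B = 1\<^sub>m n"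
    and \<pi>: "\<pi> permutes {..<n}"
  shows "reindex_mat \<pi> A * reindex_mat \<pi> B = 1\<^sub>m n"
proof (rule eq_matI)
  fix i j assume "i < dim_row (1\<^sub>m n :: 'a mat)" "j < dim_col (1\<^sub>m n :: 'a mat)"
  then have ij: "i < n" "j < n" by auto
  have lt: "\<pi> i < n" if "i < n" for i using permutes_in_image[OF \<pi>] that by blast
  have "(reindex_mat \<pi> A * reindex_mat \<pi> B) $$ (i, j)
      = (\<Sum>t<n. A $$ (\<pi> i, \<pi> t) * B $$ (\<pi> t, \<pi> j))"
    using AB ij by (subst mult_mat_entry[of _ n n _ n]) (auto simp: reindex_mat_def)
  also have "\<dots> = (\<Sum>t<n. A $$ (\<pi> i, t) * B $$ (t, \<pi> j))"
    by (simp add: sum.permute[OF \<pi>, of "\<lambda>t. A $$ (\<pi> i, t) * B $$ (t, \<pi> j)"] o_def)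
  also have "\<dots> = (A * B) $$ (\<pi> i, \<pi> j)"
    using AB(1,2) lt ij by (intro mult_mat_entry[symmetric]) auto
  also have "\<dots> = (1\<^sub>m n :: 'a mat) $$ (i, j)"
    using AB lt ij permutes_inj[OF \<pi>] by (auto simp: inj_eq)
  finally show "(reindex_mat \<pi> A * reindex_mat \<pi> B) $$ (i, j) = (1\<^sub>m n :: 'a mat) $$ (i, j)" .
qed (use AB in \<open>auto simp: reindex_mat_def\<close>)

text \<open>Reindexing \<open>B\<close> in the same way inverts \<open>C\<close>, and reindexing
  only rearranges the entries summed in each norm.\<close>

lemma condition_number_permutation_similar:
  assumes AB: "A \<in> carrier_mat n n" "B \<in> carrier_mat n n" "A * B = 1\<^sub>m n"
    and "permutation_similar A C"
  shows "condition_number C = condition_number A"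
proof -
  obtain \<pi> where \<pi>: "\<pi> permutes {..<n}" and C: "C = reindex_mat \<pi> A"
    using assms perm_matrix_conj unfolding permutation_similar_def by auto
  have "reindex_mat \<pi> A \<in> carrier_mat n n" "reindex_mat \<pi> B \<in> carrier_mat n n"
    using AB by (auto simp: reindex_mat_def)
  then show ?thesis
    unfolding C
    by (simp add: condition_number_eq[OF _ _ reindex_mat_inverse[OF AB \<pi>]]
        condition_number_eq[OF AB] norm_sq_reindex[OF AB(1) \<pi>] norm_sq_reindex[OF AB(2) \<pi>])
qed

lemma condition_number_matrix_equivalent:
  assumes AB: "A \<in> carrier_mat n n" "B \<in> carrier_mat n n" "A * B = 1\<^sub>m n"
    and eq: "matrix_equivalent A C"
  shows "condition_number C = condition_number A"
proof -
  \<comment> \<open>Transposition reverses products, so the transposes are inverse to each other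
    because of \<open>B * A\<close>, not \<open>A * B\<close>.\<close>
  have BA: "B * A = 1\<^sub>m n" using mat_mult_left_right_inverse AB by blast
  have T: "transpose_mat A \<in> carrier_mat n n" "transpose_mat B \<in> carrier_mat n n"
    "transpose_mat A * transpose_mat B = 1\<^sub>m n"
    using AB BA by (simp_all flip: transpose_mult)
  have "condition_number (transpose_mat A) = condition_number A"
    by (simp add: condition_number_eq[OF T] condition_number_eq[OF AB] norm_sq_transpose)
  then show ?thesis
    using eq condition_number_permutation_similar[OF AB] condition_number_permutation_similar[OF T]
    unfolding matrix_equivalent_def by auto
qed

section \<open>Products of Fiedler factors\<close>

text \<open>The identity with the symmetric block \<open>[[a, 1], [1, b]]\<close> placed in rows and
  columns \<open>r\<close>, \<open>Suc r\<close>. Two free parameters let one family contain the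
  Fiedler factors and their inverses.\<close>

definition block_factor :: "nat \<Rightarrow> nat \<Rightarrow> 'a \<Rightarrow> 'a \<Rightarrow> 'a :: semiring_1 mat" where
  "block_factor n r a b = mat n n (\<lambda>(i, j).
     if i = r then (if j = r then a else if j = Suc r then 1 else 0)
     else if i = Suc r then (if j = r then 1 else if j = Suc r then b else 0)
     else if i = j then 1 else 0)"

lemma block_factor_carrier [simp]: "block_factor n r a b \<in> carrier_mat n n"
  by (simp add: block_factor_def)

lemma block_factor_mult:
  assumes M: "M \<in> carrier_mat n l" and r: "Suc r < n" and ij: "i < n" "j < l"
  shows "(block_factor n r a b * M) $$ (i, j) =
    (if i = r then a * M $$ (r, j) + M $$ (Suc r, j)
     else if i = Suc r then M $$ (r, j) + b * M $$ (Suc r, j)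
     else M $$ (i, j))"
proof -
  have two: "(\<Sum>t<n. f t) = f r + f (Suc r)" if "\<And>t. t < n \<Longrightarrow> t \<noteq> r \<Longrightarrow> t \<noteq> Suc r \<Longrightarrow> f t = 0"
    for f :: "nat \<Rightarrow> 'a"
  proof -
    have "(\<Sum>t<n. f t) = sum f {r, Suc r}"
      using that r by (intro sum.mono_neutral_right) auto
    then show ?thesis by simp
  qed
  show ?thesis
  proof (cases "i = r \<or> i = Suc r")
    case True
    have "(block_factor n r a b * M) $$ (i, j) = (\<Sum>t<n. block_factor n r a b $$ (i, t) * M $$ (t, j))"
      using M ij by (intro mult_mat_entry) auto
    also have "\<dots> = block_factor n r a b $$ (i, r) * M $$ (r, j)
        + block_factor n r a b $$ (i, Suc r) * M $$ (Suc r, j)"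
      using True ij by (intro two) (auto simp: block_factor_def)
    finally show ?thesis using True ij r by (auto simp: block_factor_def)
  next
    case False
    then have "(block_factor n r a b * M) $$ (i, j) =
        (\<Sum>t<n. if i = t then M $$ (t, j) else 0)"
      unfolding mult_mat_entry[OF block_factor_carrier M ij]
      using ij by (intro sum.cong) (auto simp: block_factor_def)
    with False ij show ?thesis by simp
  qed
qed

text \<open>The factor \<open>F_0\<close> for \<open>c_0 = 1\<close>.\<close>

definition last_sign :: "nat \<Rightarrow> 'a :: ring_1 mat" where
  "last_sign n = mat_diag n (\<lambda>i. if i = n - 1 then - 1 else 1)"

lemma last_sign_carrier [simp]: "last_sign n \<in> carrier_mat n n"
  by (simp add: last_sign_def)

text \<open>The Fiedler factors for \<open>c\<^sub>0 = 1\<close> are the case \<open>a q = - c\<^sub>q\<close>, \<open>b = 0\<close>; their inverses are the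
  case \<open>a = 0\<close>, \<open>b q = c\<^sub>q\<close>.\<close>

definition factor :: "nat \<Rightarrow> (nat \<Rightarrow> 'a) \<Rightarrow> (nat \<Rightarrow> 'a) \<Rightarrow> nat \<Rightarrow> 'a :: ring_1 mat" where
  "factor n a b q = (if q = 0 then last_sign n else block_factor n (n - Suc q) (a q) (b q))"

lemma factor_carrier [simp]: "factor n a b q \<in> carrier_mat n n"
  by (simp add: factor_def)

lemma factor_dim [simp]: "dim_row (factor n a b q) = n" "dim_col (factor n a b q) = n"
  using factor_carrier[of n a b q] by (auto simp del: factor_carrier)

text \<open>The blocks are disjoint: the factor of index \<open>q\<close> acts on rows
  \<open>n - q - 1\<close> and \<open>n - q\<close>, that of index \<open>j\<close> on rows from
  \<open>n - j - 1\<close> on, and \<open>n - q < n - j - 1\<close>. For \<open>j = 0\<close> only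
  the sign of row \<open>n - 1\<close> changes.\<close>

lemma factor_commute:
  fixes a b :: "nat \<Rightarrow> 'a :: comm_ring_1"
  assumes "Suc j < q" "q < n"
  shows "factor n a b q * factor n a b j = factor n a b j * factor n a b q"
proof (rule eq_matI)
  fix s t assume "s < dim_row (factor n a b j * factor n a b q)"
    "t < dim_col (factor n a b j * factor n a b q)"
  then have st: "s < n" "t < n" by auto
  have q: "Suc (n - Suc q) < n" using assms by simp
  show "(factor n a b q * factor n a b j) $$ (s, t) = (factor n a b j * factor n a b q) $$ (s, t)"
  proof (cases "j = 0")
    case True
    have "(factor n a b q * factor n a b j) $$ (s, t) =
      (block_factor n (n - Suc q) (a q) (b q) * last_sign n) $$ (s, t)"
      "(factor n a b j * factor n a b q) $$ (s, t) =
      (if s = n - 1 then -1 else 1) * block_factor n (n - Suc q) (a q) (b q) $$ (s, t)"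
      using True assms st
      by (simp_all add: factor_def last_sign_def mat_diag_mult_left[OF block_factor_carrier])
    with assms st q show ?thesis
      by (simp add: block_factor_mult[OF last_sign_carrier q])
        (auto simp: block_factor_def last_sign_def mat_diag_def)
  next
    case False
    have j: "Suc (n - Suc j) < n" using assms False by simp
    have ne: "n - Suc q < n - Suc j" "Suc (n - Suc q) < n - Suc j" using assms by auto
    have "(factor n a b q * factor n a b j) =
      block_factor n (n - Suc q) (a q) (b q) * block_factor n (n - Suc j) (a j) (b j)"
      "(factor n a b j * factor n a b q) =
      block_factor n (n - Suc j) (a j) (b j) * block_factor n (n - Suc q) (a q) (b q)"
      using False assms by (simp_all add: factor_def)
    with st ne q j show ?thesis
      by (simp add: block_factor_mult[OF block_factor_carrier]) (auto simp: block_factor_def)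
  qed
qed auto

lemma last_sign_square: "last_sign n * last_sign n = (1\<^sub>m n :: 'a :: ring_1 mat)"
  unfolding last_sign_def
  by (subst mat_diag_mult_left[of _ n n]) (auto simp: mat_diag_def)

text \<open>On the block this is \<open>[[a, 1], [1, 0]] * [[0, 1], [1, -a]] = 1\<close>; for
  \<open>q = 0\<close> the sign matrix is an involution.\<close>

lemma factor_inverse:
  assumes "q < n"
  shows "factor n a (\<lambda>_. 0) q * factor n (\<lambda>_. 0) (\<lambda>i. - a i) q = (1\<^sub>m n :: 'a :: ring_1 mat)"
proof (cases "q = 0")
  case True
  then show ?thesis by (simp add: factor_def last_sign_square)
next
  case False
  then have q: "Suc (n - Suc q) < n" using assms by simp
  show ?thesis
    using False q
    by (intro eq_matI)
      (simp_all add: factor_def block_factor_mult[OF block_factor_carrier q],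
        auto simp: block_factor_def)
qed

section \<open>Products along a list, and moving one factor to an end\<close>

definition mat_prod :: "nat \<Rightarrow> ('b \<Rightarrow> 'a :: semiring_1 mat) \<Rightarrow> 'b list \<Rightarrow> 'a mat" where
  "mat_prod n f xs = foldr (\<lambda>i M. f i * M) xs (1\<^sub>m n)"

lemma mat_prod_simps [simp]:
  "mat_prod n f [] = 1\<^sub>m n" "mat_prod n f (x # xs) = f x * mat_prod n f xs"
  by (simp_all add: mat_prod_def)

lemma mat_prod_carrier:
  "(\<And>x. x \<in> set xs \<Longrightarrow> f x \<in> carrier_mat n n) \<Longrightarrow> mat_prod n f xs \<in> carrier_mat n n"
  by (induction xs) (auto intro: mult_carrier_mat)

lemma mat_prod_append:
  assumes "\<And>x. f x \<in> carrier_mat n n"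
  shows "mat_prod n f (xs @ ys) = mat_prod n f xs * mat_prod n f ys"
proof (induction xs)
  case Nil
  then show ?case using mat_prod_carrier[of ys f n] assms by simp
next
  case (Cons x xs)
  then show ?case
    by (simp add: assoc_mult_mat[OF assms mat_prod_carrier mat_prod_carrier] assms)
qed

lemma mat_prod_commute:
  assumes c: "\<And>x. f x \<in> carrier_mat n n" and "A \<in> carrier_mat n n"
    and "\<And>x. x \<in> set xs \<Longrightarrow> A * f x = f x * A"
  shows "A * mat_prod n f xs = mat_prod n f xs * A"
  using assms(3)
proof (induction xs)
  case Nil
  then show ?case using assms by simp
next
  case (Cons x xs)
  let ?P = "mat_prod n f xs"
  have P: "?P \<in> carrier_mat n n" by (rule mat_prod_carrier) (rule c)
  have "A * (f x * ?P) = A * f x * ?P"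
    by (rule assoc_mult_mat[OF assms(2) c P, symmetric])
  also have "A * f x = f x * A" using Cons.prems by simp
  also have "f x * A * ?P = f x * (A * ?P)"
    by (rule assoc_mult_mat[OF c assms(2) P])
  also have "\<dots> = f x * ?P * A"
    using Cons assoc_mult_mat[OF c P assms(2)] by simp
  finally show ?case by simp
qed

text \<open>With the second list reversed, the products of the two tails meet in the middle and
  cancel by induction, leaving \<open>f x * g x\<close>.\<close>

lemma mat_prod_inverse:
  assumes c: "\<And>x. f x \<in> carrier_mat n n" "\<And>x. g x \<in> carrier_mat n n"
    and "\<And>x. x \<in> set xs \<Longrightarrow> f x * g x = 1\<^sub>m n"
  shows "mat_prod n f xs * mat_prod n g (rev xs) = 1\<^sub>m n"
  using assms(3)
proof (induction xs)
  case (Cons x xs)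
  let ?P = "mat_prod n f xs" and ?Q = "mat_prod n g (rev xs)"
  have P: "?P \<in> carrier_mat n n" and Q: "?Q \<in> carrier_mat n n"
    by (rule mat_prod_carrier, rule c)+
  have "mat_prod n f (x # xs) * mat_prod n g (rev (x # xs)) = f x * ?P * (?Q * g x)"
    using c by (simp add: mat_prod_append right_mult_one_mat[OF c(2)])
  also have "\<dots> = f x * (?P * ?Q * g x)"
    using c P Q by (simp add: assoc_mult_mat[of _ n n _ n _ n])
  finally show ?case using Cons by (simp add: left_mult_one_mat[OF c(2)])
qed simp

text \<open>All factors but \<open>factor n a b (q - 1)\<close> commute with \<open>factor n a b q\<close>, so the latter can be
  moved to that end of the product which is not blocked by \<open>factor n a b (q - 1)\<close>.\<close>

lemma mat_prod_factor_split:
  fixes a b :: "nat \<Rightarrow> 'a :: comm_ring_1"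
  assumes "distinct xs" "set xs = {..<Suc q}" "q < n"
  obtains ys where "distinct ys" "set ys = {..<q}"
    "mat_prod n (factor n a b) xs = factor n a b q * mat_prod n (factor n a b) ys \<or>
     mat_prod n (factor n a b) xs = mat_prod n (factor n a b) ys * factor n a b q"
proof -
  let ?f = "factor n a b"
  obtain us vs where xs: "xs = us @ q # vs"
    using assms(2) by (metis lessThan_iff lessI split_list)
  have qn: "q \<notin> set us" "q \<notin> set vs" using assms(1) xs by auto
  have ys: "distinct (us @ vs)" "set (us @ vs) = {..<q}"
    using assms(1,2) qn unfolding xs by (auto simp: lessThan_Suc)
  have P: "mat_prod n ?f zs \<in> carrier_mat n n" for zs by (rule mat_prod_carrier) simp
  have comm: "?f q * mat_prod n ?f zs = mat_prod n ?f zs * ?f q"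
    if "set zs \<subseteq> {..<q}" "q - 1 \<notin> set zs" for zs
  proof (rule mat_prod_commute)
    fix x assume "x \<in> set zs"
    with that have "Suc x < q"
      by (metis Suc_lessI diff_Suc_1 lessThan_iff subsetD)
    then show "?f q * ?f x = ?f x * ?f q" using factor_commute assms(3) by blast
  qed auto
  have X: "mat_prod n ?f xs = mat_prod n ?f us * (?f q * mat_prod n ?f vs)"
    unfolding xs by (simp add: mat_prod_append)
  have Y: "mat_prod n ?f (us @ vs) = mat_prod n ?f us * mat_prod n ?f vs"
    by (simp add: mat_prod_append)
  \<comment> \<open>By distinctness \<open>q - 1\<close> lies on at most one side of
    \<open>q\<close>; on a side without it every factor commutes with that of index
    \<open>q\<close>. For \<open>q = 0\<close> both sides are empty.\<close>
  have "q - 1 \<notin> set us \<or> q - 1 \<notin> set vs" using ys by auto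
  then show thesis
  proof
    assume "q - 1 \<notin> set us"
    then have "?f q * mat_prod n ?f us = mat_prod n ?f us * ?f q" using comm ys by auto
    then have "mat_prod n ?f xs = ?f q * mat_prod n ?f (us @ vs)"
      unfolding X Y using P by (simp flip: assoc_mult_mat[of _ n n _ n _ n])
    then show thesis using that ys by blast
  next
    assume "q - 1 \<notin> set vs"
    then have "?f q * mat_prod n ?f vs = mat_prod n ?f vs * ?f q" using comm ys by auto
    then have "mat_prod n ?f xs = mat_prod n ?f (us @ vs) * ?f q"
      unfolding X Y using P by (simp add: assoc_mult_mat[of _ n n _ n _ n])
    then show thesis using that ys by blast
  qed
qed

section \<open>Growth of the norm when the product is extended by one factor\<close>

text \<open>\<open>corner n r Z N M\<close>: \<open>M\<close> is the identity of order \<open>r\<close> bordered by a block whose first row and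
  column are, if \<open>Z\<close> holds, of norm 1.\<close>

definition corner :: "nat \<Rightarrow> nat \<Rightarrow> bool \<Rightarrow> real \<Rightarrow> real mat \<Rightarrow> bool" where
  "corner n r Z N M \<longleftrightarrow> M \<in> carrier_mat n n \<and>
     (\<forall>i<n. \<forall>j<n. i < r \<or> j < r \<longrightarrow> M $$ (i, j) = (if i = j then 1 else 0)) \<and>
     norm_sq M = N \<and>
     (Z \<longrightarrow> row_norm_sq M r = 1 \<and> row_norm_sq (transpose_mat M) r = 1)"

lemma corner_transpose:
  assumes "r < n" "corner n r Z N M"
  shows "corner n r Z N (transpose_mat M)"
  using assms unfolding corner_def by (auto simp: norm_sq_transpose)

lemma sum_split_two:
  fixes f :: "nat \<Rightarrow> 'a :: comm_monoid_add"
  assumes "Suc r < n"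
  shows "(\<Sum>i<n. f i) = f r + (f (Suc r) + (\<Sum>i\<in>{..<n} - {r, Suc r}. f i))"
proof -
  have "{..<n} = insert r (insert (Suc r) ({..<n} - {r, Suc r}))" using assms by auto
  then have "(\<Sum>i<n. f i) = sum f (insert r (insert (Suc r) ({..<n} - {r, Suc r})))" by simp
  also have "\<dots> = f r + (f (Suc r) + (\<Sum>i\<in>{..<n} - {r, Suc r}. f i))"
    by (subst sum.insert; (subst sum.insert)?; simp)
  finally show ?thesis .
qed

text \<open>Row \<open>r\<close> of \<open>M\<close> is a unit vector and row \<open>Suc r\<close>
  vanishes in column \<open>r\<close>. The new rows \<open>r\<close> and \<open>Suc r\<close> are
  therefore sums with disjoint supports, of squared norms \<open>a^2 + R\<close> and
  \<open>1 + b^2 * R\<close>, where \<open>R\<close> is the squared norm of the old row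
  \<open>Suc r\<close>. The total grows by \<open>a^2 + b^2 * R\<close>. Either
  \<open>b = 0\<close>, or \<open>Z\<close> gives \<open>R = 1\<close>; in the latter case
  \<open>a = 0\<close> restores the norm conditions one index lower.\<close>

lemma corner_block_factor_mult:
  assumes M: "corner n (Suc r) Z N M" and r: "Suc r < n"
    and ab: "if Z then a = 0 else b = 0"
  shows "corner n r Z (N + a\<^sup>2 + b\<^sup>2) (block_factor n r a b * M)"
proof -
  define E where "E = block_factor n r a b * M"
  have Mc: "M \<in> carrier_mat n n"
    and id: "\<And>i j. i < n \<Longrightarrow> j < n \<Longrightarrow> i < Suc r \<or> j < Suc r \<Longrightarrow> M $$ (i, j) = (if i = j then 1 else 0)"
    and N: "norm_sq M = N"
    and Z: "Z \<Longrightarrow> row_norm_sq M (Suc r) = 1"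
    using M unfolding corner_def by auto
  have Ec: "E \<in> carrier_mat n n"
    unfolding E_def using Mc by (rule mult_carrier_mat[OF block_factor_carrier])
  have E: "E $$ (i, j) = (if i = r then a * M $$ (r, j) + M $$ (Suc r, j)
     else if i = Suc r then M $$ (r, j) + b * M $$ (Suc r, j)
     else M $$ (i, j))" if "i < n" "j < n" for i j
    using block_factor_mult[OF Mc r that] by (simp add: E_def)
  have Er: "(E $$ (r, j))\<^sup>2 = (if j = r then a\<^sup>2 else 0) + (M $$ (Suc r, j))\<^sup>2"
    and Er': "(E $$ (Suc r, j))\<^sup>2 = (if j = r then 1 else 0) + b\<^sup>2 * (M $$ (Suc r, j))\<^sup>2"
    if "j < n" for j
    using that r id[of r j] id[of "Suc r" j] by (auto simp: E power_mult_distrib)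
  have row_r: "row_norm_sq E r = a\<^sup>2 + row_norm_sq M (Suc r)"
    using Ec Mc r by (simp add: row_norm_sq_def Er sum.distrib)
  have row_r': "row_norm_sq E (Suc r) = 1 + b\<^sup>2 * row_norm_sq M (Suc r)"
    using Ec Mc r by (simp add: row_norm_sq_def Er' sum.distrib sum_distrib_left)
  have M_r: "row_norm_sq M r = 1"
  proof -
    have "row_norm_sq M r = (\<Sum>j<n. if r = j then 1 else 0)"
      unfolding row_norm_sq_def using Mc r id by (intro sum.cong) auto
    then show ?thesis using r by simp
  qed
  have rest: "row_norm_sq E i = row_norm_sq M i" if "i < n" "i \<noteq> r" "i \<noteq> Suc r" for i
    using Ec Mc that by (simp add: row_norm_sq_def E)
  have "norm_sq E = norm_sq M + a\<^sup>2 + b\<^sup>2 * row_norm_sq M (Suc r)"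
    using Ec Mc r by (simp add: norm_sq_def sum_split_two[OF r] row_r row_r' M_r rest)
  then have norm: "norm_sq E = N + a\<^sup>2 + b\<^sup>2"
    using ab N Z by (auto split: if_splits)
  \<comment> \<open>Only two entries of column \<open>r\<close> can be nonzero: \<open>a\<close> in
    row \<open>r\<close> and 1 below it.\<close>
  have col: "row_norm_sq (transpose_mat E) r = a\<^sup>2 + 1"
  proof -
    have "row_norm_sq (transpose_mat E) r = (\<Sum>i<n. (E $$ (i, r))\<^sup>2)"
      using Ec r by (simp add: row_norm_sq_def)
    also have "\<dots> = (\<Sum>i<n. (if i = r then a\<^sup>2 else 0) + (if i = Suc r then 1 else 0))"
      using r by (intro sum.cong) (auto simp: E id)
    finally show ?thesis using r by (simp add: sum.distrib)
  qed
  have "corner n r Z (N + a\<^sup>2 + b\<^sup>2) E"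
    unfolding corner_def using Ec norm col row_r Z ab r by (auto simp: E id split: if_splits)
  then show ?thesis by (simp add: E_def)
qed

lemma transpose_block_factor: "transpose_mat (block_factor n r a b) = block_factor n r a b"
  by (rule eq_matI) (auto simp: block_factor_def)

text \<open>Follows by transposition, as the block factor is symmetric and \<open>corner\<close>
  treats rows and columns alike.\<close>

lemma corner_mult_block_factor:
  fixes a b :: real
  assumes M: "corner n (Suc r) Z N M" and r: "Suc r < n"
    and ab: "if Z then a = 0 else b = 0"
  shows "corner n r Z (N + a\<^sup>2 + b\<^sup>2) (M * block_factor n r a b)"
proof -
  have Mc: "M \<in> carrier_mat n n" using M by (simp add: corner_def)
  have "corner n r Z (N + a\<^sup>2 + b\<^sup>2) (transpose_mat (block_factor n r a b * transpose_mat M))"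
    using corner_block_factor_mult[OF corner_transpose[OF r M] r ab] corner_transpose r by simp
  also have "transpose_mat (block_factor n r a b * transpose_mat M) = M * block_factor n r a b"
    using Mc by (subst transpose_mult[of _ n n _ n]) (auto simp: transpose_block_factor)
  finally show ?thesis .
qed

text \<open>Start of the induction, for either value of \<open>Z\<close>: each row and column has a
  single nonzero entry, which is 1 or -1.\<close>

lemma corner_last_sign:
  assumes "n > 0"
  shows "corner n (n - 1) Z (real n) (last_sign n)"
proof -
  have 1: "row_norm_sq (last_sign n) i = 1" if "i < n" for i
  proof -
    have "row_norm_sq (last_sign n) i = (\<Sum>j<n. if i = j then 1 else 0)"
      unfolding row_norm_sq_def using that
      by (intro sum.cong) (auto simp: last_sign_def mat_diag_def)
    then show ?thesis using that by simp
  qed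
  have "transpose_mat (last_sign n) = (last_sign n :: real mat)"
    by (rule eq_matI) (auto simp: last_sign_def mat_diag_def)
  then show ?thesis
    unfolding corner_def using assms 1 carrier_matD[OF last_sign_carrier, of n]
    by (auto simp: norm_sq_def) (auto simp: last_sign_def mat_diag_def)
qed

text \<open>Induction on the largest index: its factor can be brought to the left or right end, and
  its block reaches one row above the part already built. Both sides give the same gain, so the
  order of the factors does not affect the norm.\<close>

lemma corner_mat_prod_factor:
  assumes "distinct xs" "set xs = {..q}" "q < n"
    and "\<And>i. if Z then a i = 0 else b i = 0"
  shows "corner n (n - Suc q) Z (real n + (\<Sum>i=1..q. (a i)\<^sup>2 + (b i)\<^sup>2)) (mat_prod n (factor n a b) xs)"
  using assms(1-3)
proof (induction q arbitrary: xs)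
  case 0
  then have "xs = [0]"
    by (metis atMost_0 distinct_singleton distinct_length_2_or_more empty_iff empty_set
        insert_iff list.exhaust list.set_intros(1) list.set_intros(2) singletonD)
  then show ?case
    using corner_last_sign[of n Z] 0 by (simp add: factor_def right_mult_one_mat[OF last_sign_carrier])
next
  case (Suc q)
  obtain ys where ys: "distinct ys" "set ys = {..<Suc q}" and
    P: "mat_prod n (factor n a b) xs = factor n a b (Suc q) * mat_prod n (factor n a b) ys \<or>
     mat_prod n (factor n a b) xs = mat_prod n (factor n a b) ys * factor n a b (Suc q)"
    using mat_prod_factor_split[of xs "Suc q" n a b] Suc.prems by (metis lessThan_Suc_atMost)
  define r where "r = n - Suc (Suc q)"
  have r: "n - Suc q = Suc r" "Suc r < n" using Suc.prems by (auto simp: r_def)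
  have F: "factor n a b (Suc q) = block_factor n r (a (Suc q)) (b (Suc q))"
    by (simp add: factor_def r_def)
  have IH: "corner n (Suc r) Z (real n + (\<Sum>i=1..q. (a i)\<^sup>2 + (b i)\<^sup>2)) (mat_prod n (factor n a b) ys)"
    using Suc.IH[of ys] ys Suc.prems r by (simp add: lessThan_Suc_atMost)
  show ?case
    using P corner_block_factor_mult[OF IH r(2) assms(4)] corner_mult_block_factor[OF IH r(2) assms(4)]
    unfolding F r_def[symmetric] by (auto simp: add.assoc)
qed

section \<open>Condition number of the Fiedler companion matrices\<close>

lemma fiedler_factor_eq:
  assumes "coeff p 0 = 1" "q < degree p"
  shows "fiedler_factor p q = factor (degree p) (\<lambda>i. - coeff p i) (\<lambda>_. 0) q"
proof (cases "q = 0")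
  case True
  then show ?thesis using assms by (simp add: fiedler_factor_def factor_def last_sign_def Let_def cong: if_cong)
next
  case False
  \<comment> \<open>\<open>r\<close> is the size of the upper identity block; writing the degree as
    \<open>r + (2 + (q - 1))\<close> removes truncated subtraction from the block sizes.\<close>
  define r where "r = degree p - q - 1"
  have n: "degree p = r + (2 + (q - 1))" "degree p - Suc q = r" using assms False by (auto simp: r_def)
  show ?thesis
    using False unfolding fiedler_factor_def factor_def Let_def n(2) r_def[symmetric]
    by (intro eq_matI)
      (auto simp: n(1) Let_def four_block_mat_def mat_of_rows_list_def block_factor_def nth_Cons'
        numeral_2_eq_2 split: if_splits)
qed

text \<open>The inverse is the product of the inverse factors in reverse order. It has the same
  squared norm as the product itself, so the two square roots multiply to that common value.\<close>

lemma condition_number_fiedler: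
  assumes "coeff p 0 = 1" "degree p = n" "n > 0" "fiedler_companion p F"
  shows "condition_number F = real n + (\<Sum>i=1..n-1. (coeff p i)\<^sup>2)"
proof -
  obtain \<sigma> where \<sigma>: "\<sigma> permutes {..<n}" and eq: "matrix_equivalent (fiedler_product p \<sigma>) F"
    using assms unfolding fiedler_companion_def by auto
  define xs where "xs = map \<sigma> [0..<n]"
  let ?f = "factor n (\<lambda>i. - coeff p i) (\<lambda>_. 0)" and ?g = "factor n (\<lambda>_. 0) (coeff p)"
  have lt: "\<sigma> i < n" if "i < n" for i using permutes_in_image[OF \<sigma>] that by blast
  have "\<sigma> ` {..<n} = {..<n}" using \<sigma> by (rule permutes_image)
  then have xs: "distinct xs" "set xs = {..n - 1}"
    using permutes_inj_on[OF \<sigma>] \<open>n > 0\<close>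
    by (auto simp: xs_def distinct_map lessThan_atLeast0)
  have prod: "fiedler_product p \<sigma> = mat_prod n ?f xs"
    unfolding fiedler_product_def mat_prod_def xs_def foldr_map o_def assms(2)
    using lt assms by (intro foldr_cong) (auto simp: fiedler_factor_eq)
  have A: "mat_prod n ?f xs \<in> carrier_mat n n" and B: "mat_prod n ?g (rev xs) \<in> carrier_mat n n"
    by (rule mat_prod_carrier, rule factor_carrier)+
  have AB: "mat_prod n ?f xs * mat_prod n ?g (rev xs) = 1\<^sub>m n"
    using xs \<open>n > 0\<close> factor_inverse[of _ n "\<lambda>i. - coeff p i"] by (intro mat_prod_inverse) auto
  \<comment> \<open>With all factors used the border has size 0 and only the norm is read off. The
    factors have \<open>b = 0\<close>, hence \<open>False\<close>; their inverses below have
    \<open>a = 0\<close>, hence \<open>True\<close>.\<close>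
  have "corner n (n - Suc (n - 1)) False (real n + (\<Sum>i=1..n-1. (- coeff p i)\<^sup>2 + 0\<^sup>2)) (mat_prod n ?f xs)"
    using xs \<open>n > 0\<close> by (intro corner_mat_prod_factor) auto
  then have nA: "norm_sq (mat_prod n ?f xs) = real n + (\<Sum>i=1..n-1. (coeff p i)\<^sup>2)"
    by (simp add: corner_def)
  have "corner n (n - Suc (n - 1)) True (real n + (\<Sum>i=1..n-1. 0\<^sup>2 + (coeff p i)\<^sup>2))
      (mat_prod n ?g (rev xs))"
    using xs \<open>n > 0\<close> by (intro corner_mat_prod_factor) auto
  then have nB: "norm_sq (mat_prod n ?g (rev xs)) = real n + (\<Sum>i=1..n-1. (coeff p i)\<^sup>2)"
    by (simp add: corner_def)
  show ?thesis
    using condition_number_matrix_equivalent[OF A B AB] eq norm_sq_nonneg[of "mat_prod n ?f xs"]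
    by (simp add: prod condition_number_eq[OF A B AB] nA nB)
qed

text \<open>Ensures that a bound over all Fiedler companion matrices is not vacuous; both
  permutations are the identity.\<close>

lemma fiedler_companion_exists: "\<exists>F. fiedler_companion p F"
proof -
  have "permutation_similar A (perm_matrix (dim_row A) id * A * transpose_mat (perm_matrix (dim_row A) id))"
    for A
    unfolding permutation_similar_def using permutes_id by blast
  then show ?thesis
    unfolding fiedler_companion_def matrix_equivalent_def using permutes_id by blast
qed

section \<open>The striped companion matrix with equal stripes\<close>

text \<open>Among the indices from \<open>s * k\<close> to \<open>s * k + k - 1\<close> only the
  first is a multiple of \<open>k\<close>.\<close>

lemma sum_if_dvd:
  fixes f :: "nat \<Rightarrow> 'a :: comm_monoid_add"
  assumes "k > 0"
  shows "(\<Sum>i<m * k. if k dvd i then f (i div k) else 0) = (\<Sum>s<m. f s)"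
proof -
  have "(\<Sum>i=s*k..<s*k+k. if k dvd i then f (i div k) else 0) = f s" for s
  proof -
    have "(\<Sum>i=s*k..<s*k+k. if k dvd i then f (i div k) else 0)
        = (\<Sum>i\<in>{s*k}. if k dvd i then f (i div k) else 0)"
    proof (rule sum.mono_neutral_right)
      show "\<forall>i\<in>{s*k..<s*k+k} - {s*k}. (if k dvd i then f (i div k) else 0) = 0"
      proof
        fix i assume i: "i \<in> {s*k..<s*k+k} - {s*k}"
        have "\<not> k dvd i"
        proof
          assume "k dvd i"
          then obtain t where "i = k * t" by blast
          with i have "s * k < t * k" "t * k < Suc s * k" by (auto simp: mult.commute)
          then have "s < t" "t < Suc s" using mult_less_cancel2 by blast+
          then show False by simp
        qed
        then show "(if k dvd i then f (i div k) else 0) = 0" by simp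
      qed
    qed (use assms in auto)
    then show ?thesis using assms by simp
  qed
  then show ?thesis by (simp flip: sum.nat_group)
qed

text \<open>On a stripe \<open>j \<le> i\<close>, so stripes never meet the superdiagonal and the
  case distinction becomes a difference, convenient for summation. The same inequality turns the
  coefficient index into \<open>n - Suc i + j\<close>.\<close>

lemma striped_matrix_replicate_entry:
  assumes "degree p = n" "n = k * (m + 1)" "k > 0" "i < n" "j < n"
  shows "striped_matrix p (replicate (m + 1) k) $$ (i, j) =
    (if j = Suc i then 1 else 0) - (if k dvd Suc i \<and> j < k then coeff p (n - Suc i + j) else 0)"
proof -
  have stripe: "(\<exists>l<m + 1. i + 1 = sum_list (take (l + 1) (replicate (m + 1) k)) \<and>
      j < replicate (m + 1) k ! l) \<longleftrightarrow> k dvd Suc i \<and> j < k"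
  proof -
    have "sum_list (take (l + 1) (replicate (m + 1) k)) = k * (l + 1)" if "l < m + 1" for l
    proof -
      have "min (l + 1) (m + 1) = l + 1" using that by simp
      then show ?thesis by (simp only: take_replicate sum_list_replicate mult.commute of_nat_id)
    qed
    then have "(\<exists>l<m + 1. i + 1 = sum_list (take (l + 1) (replicate (m + 1) k)) \<and>
        j < replicate (m + 1) k ! l) \<longleftrightarrow> (\<exists>l<m + 1. Suc i = k * (l + 1)) \<and> j < k"
      by (metis Suc_eq_plus1 nth_replicate)
    also have "(\<exists>l<m + 1. Suc i = k * (l + 1)) \<longleftrightarrow> k dvd Suc i"
    proof
      assume "k dvd Suc i"
      then obtain t where t: "Suc i = k * t" by blast
      then have "t > 0" by (cases t) auto
      moreover have "k * t \<le> k * (m + 1)" using assms t by simp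
      then have "t \<le> m + 1" using \<open>k > 0\<close> by (simp del: mult_Suc_right)
      \<comment> \<open>Stripes are numbered from 0, so the row with \<open>Suc i = k * t\<close>
        carries stripe \<open>t - 1\<close>.\<close>
      ultimately show "\<exists>l<m + 1. Suc i = k * (l + 1)"
        using t by (intro exI[of _ "t - 1"]) auto
    qed auto
    finally show ?thesis .
  qed
  have le: "j \<le> i" if "k dvd Suc i" "j < k" using dvd_imp_le[OF that(1)] that(2) by simp
  have entry: "striped_matrix p (replicate (m + 1) k) $$ (i, j) =
    (if j = i + 1 then 1 else if k dvd Suc i \<and> j < k then - coeff p (n - 1 - (i - j)) else 0)"
    unfolding striped_matrix_def assms(1) length_replicate index_mat(1)[OF assms(4,5)] prod.case stripe
    by (rule refl)
  show ?thesis
    unfolding entry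
  proof (cases "k dvd Suc i \<and> j < k")
    case True
    then have "j \<le> i" using le by blast
    then have "n - 1 - (i - j) = n - Suc i + j" using assms(4) by arith
    with True \<open>j \<le> i\<close> show "(if j = i + 1 then 1
      else if k dvd Suc i \<and> j < k then - coeff p (n - 1 - (i - j)) else 0) =
      (if j = Suc i then 1 else 0) - (if k dvd Suc i \<and> j < k then coeff p (n - Suc i + j) else 0)"
      by simp
  qed auto
qed

text \<open>Solving \<open>S x = y\<close>: the rows without a stripe give \<open>x\<^sub>i = y\<^sub>i\<^sub>-\<^sub>1\<close> unless \<open>k\<close> divides \<open>i\<close>; the
  last row then gives \<open>x\<^sub>0\<close>, and the remaining stripes the other \<open>x\<^sub>i\<close>. As \<open>c\<^sub>n = 1\<close> and
  \<open>c\<^sub>n\<^sub>+\<^sub>j = 0\<close> for \<open>j > 0\<close>, the same formula covers \<open>i = 0\<close>.\<close>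

definition striped_inverse :: "real poly \<Rightarrow> nat \<Rightarrow> real mat" where
  "striped_inverse p k = (let n = degree p in mat n n (\<lambda>(i, j).
     (if Suc j = i then 1 else 0) +
     (if k dvd i then (if Suc j < k then coeff p (n - i + Suc j) else 0)
        - coeff p (n - i) * (if Suc j = n then 1 else if Suc j < k then coeff p (Suc j) else 0)
      else 0)))"

lemma striped_carrier:
  assumes "degree p = n"
  shows "striped_matrix p ts \<in> carrier_mat n n" "striped_inverse p k \<in> carrier_mat n n"
  using assms by (simp_all add: striped_matrix_def striped_inverse_def)

lemma striped_mult_inverse:
  assumes n: "degree p = n" "n = k * (m + 1)" and k: "k > 0" and m: "m > 0"
    and c: "lead_coeff p = 1" "coeff p 0 = 1"
  shows "striped_matrix p (replicate (m + 1) k) * striped_inverse p k = 1\<^sub>m n"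
proof (rule eq_matI)
  fix i j assume "i < dim_row (1\<^sub>m n :: real mat)" "j < dim_col (1\<^sub>m n :: real mat)"
  then have ij: "i < n" "j < n" by auto
  let ?S = "striped_matrix p (replicate (m + 1) k)" and ?T = "striped_inverse p k"
  \<comment> \<open>\<open>- w\<close> is the top entry of column \<open>j\<close> of the inverse,
    that is \<open>x_0\<close> when \<open>y\<close> is the unit vector of index
    \<open>j\<close>.\<close>
  define w where "w = (if Suc j = n then 1 else if Suc j < k then coeff p (Suc j) else 0)"
  define d where "d = n - Suc i"
  have kn: "k < n" and dvd_n: "k dvd n" using n k m by auto
  have cn: "coeff p n = 1" using c n by simp
  have T: "?T $$ (s, j) = (if Suc j = s then 1 else 0) +
     (if k dvd s then (if Suc j < k then coeff p (n - s + Suc j) else 0) - coeff p (n - s) * w else 0)"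
    if "s < n" for s
    using that ij n(1) by (simp add: striped_inverse_def w_def)
  have T0: "?T $$ (0, j) = - w"
    using kn cn n(1) by (subst T) (auto simp: coeff_eq_0)
  have Tq: "?T $$ (q, j) = (if Suc j = q then 1 else 0)" if "0 < q" "q < k" for q
    using kn that by (subst T) (auto dest: dvd_imp_le)
  have "(?S * ?T) $$ (i, j) = (\<Sum>t<n. ?S $$ (i, t) * ?T $$ (t, j))"
    using ij striped_carrier[OF n(1)] by (simp add: mult_mat_entry[of _ n n _ n])
  also have "\<dots> = (\<Sum>t<n. (if t = Suc i then ?T $$ (t, j) else 0)
      - (if t < k then (if k dvd Suc i then coeff p (d + t) * ?T $$ (t, j) else 0) else 0))"
  proof (rule sum.cong)
    fix t assume "t \<in> {..<n}"
    then have t: "t < n" by simp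
    show "?S $$ (i, t) * ?T $$ (t, j) = (if t = Suc i then ?T $$ (t, j) else 0)
      - (if t < k then (if k dvd Suc i then coeff p (d + t) * ?T $$ (t, j) else 0) else 0)"
      by (subst striped_matrix_replicate_entry[OF n k ij(1) t]) (simp add: d_def left_diff_distrib)
  qed simp
  also have "\<dots> = (\<Sum>t<n. if t = Suc i then ?T $$ (t, j) else 0)
      - (\<Sum>t<n. if t < k then (if k dvd Suc i then coeff p (d + t) * ?T $$ (t, j) else 0) else 0)"
    by (rule sum_subtractf)
  also have "(\<Sum>t<n. if t < k then (if k dvd Suc i then coeff p (d + t) * ?T $$ (t, j) else 0) else 0)
      = (\<Sum>t<k. if k dvd Suc i then coeff p (d + t) * ?T $$ (t, j) else 0)"
    using kn by (intro sum.mono_neutral_cong_right) auto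
  also have "\<dots> = (if k dvd Suc i then \<Sum>t<k. coeff p (d + t) * ?T $$ (t, j) else 0)"
    by simp
  also have "(\<Sum>t<k. coeff p (d + t) * ?T $$ (t, j))
      = (\<Sum>t<k. (if t = 0 then - coeff p d * w else 0) + (if t = Suc j then coeff p (d + t) else 0))"
    by (intro sum.cong) (auto simp: T0 Tq)
  also have "\<dots> = (if Suc j < k then coeff p (d + Suc j) else 0) - coeff p d * w"
    using k by (simp add: sum.distrib)
  also have "(\<Sum>t<n. if t = Suc i then ?T $$ (t, j) else 0) - (if k dvd Suc i then
      (if Suc j < k then coeff p (d + Suc j) else 0) - coeff p d * w else 0)
      = (if i = j then 1 else 0)"
  proof (cases "Suc i < n")
    case True
    then show ?thesis by (simp add: T d_def)
  next
    \<comment> \<open>In the last row no superdiagonal entry is left and \<open>d = 0\<close>, so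
      \<open>c_0 = 1\<close> leaves \<open>w\<close> minus its coefficient part. By
      \<open>k < n\<close> the cases \<open>Suc j = n\<close> and \<open>Suc j < k\<close> of
      \<open>w\<close> exclude each other.\<close>
    case False
    then have "Suc i = n" using ij by simp
    then show ?thesis using c dvd_n kn ij by (auto simp: d_def w_def)
  qed
  finally show "(?S * ?T) $$ (i, j) = (1\<^sub>m n :: real mat) $$ (i, j)" using ij by simp
qed (use striped_carrier[OF n(1)] in auto)

section \<open>Norms of the striped matrix and of its inverse\<close>

lemma sum_if_Suc_less:
  fixes f :: "nat \<Rightarrow> 'a :: comm_monoid_add"
  assumes "k \<le> n"
  shows "(\<Sum>j<n. if Suc j < k then f (Suc j) else 0) = (\<Sum>i=1..k-1. f i)"
proof -
  have "(\<Sum>j<n. if Suc j < k then f (Suc j) else 0) = (\<Sum>j<k-1. f (Suc j))"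
    using assms by (intro sum.mono_neutral_cong_right) auto
  then show ?thesis by (simp add: sum.atLeast1_atMost_eq)
qed

text \<open>There are \<open>n - 1\<close> ones above the diagonal, and the stripes list each of
  \<open>c_0\<close> to \<open>c_(n-1)\<close> exactly once.\<close>

lemma norm_sq_striped_matrix:
  assumes n: "degree p = n" "n = k * (m + 1)" and k: "k > 0"
  shows "norm_sq (striped_matrix p (replicate (m + 1) k)) = real n - 1 + (\<Sum>i<n. (coeff p i)\<^sup>2)"
proof -
  let ?S = "striped_matrix p (replicate (m + 1) k)"
  let ?g = "\<lambda>i. \<Sum>q<k. (coeff p (i + q))\<^sup>2"
  have n0: "n > 0" "k \<le> n" "k dvd n" using n k by auto
  have row: "row_norm_sq ?S i = (if Suc i = n then 0 else 1) + (if k dvd Suc i then ?g (n - Suc i) else 0)"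
    if i: "i < n" for i
  proof -
    have sq: "(?S $$ (i, j))\<^sup>2 = (if j = Suc i then 1 else 0) +
        (if j < k then (if k dvd Suc i then (coeff p (n - Suc i + j))\<^sup>2 else 0) else 0)" if "j < n" for j
      using striped_matrix_replicate_entry[OF n k i that] by (auto dest: dvd_imp_le)
    have "row_norm_sq ?S i = (\<Sum>j<n. (?S $$ (i, j))\<^sup>2)"
      using carrier_matD(2)[OF striped_carrier(1)[OF n(1)]] by (simp add: row_norm_sq_def)
    also have "\<dots> = (\<Sum>j<n. if j = Suc i then 1 else 0) +
        (\<Sum>j<n. if j < k then (if k dvd Suc i then (coeff p (n - Suc i + j))\<^sup>2 else 0) else 0)"
      unfolding sum.distrib[symmetric] using sq by (intro sum.cong) auto
    also have "(\<Sum>j<n. if j < k then (if k dvd Suc i then (coeff p (n - Suc i + j))\<^sup>2 else 0) else 0)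
        = (\<Sum>j<k. if k dvd Suc i then (coeff p (n - Suc i + j))\<^sup>2 else 0)"
      using n0 by (intro sum.mono_neutral_cong_right) auto
    finally show ?thesis using i by auto
  qed
  have "norm_sq ?S = (\<Sum>i<n. row_norm_sq ?S i)"
    using carrier_matD(1)[OF striped_carrier(1)[OF n(1)]] by (simp add: norm_sq_def)
  \<comment> \<open>Counted from the bottom, row \<open>n - Suc i\<close> has a stripe exactly if
    \<open>k dvd i\<close>, and that stripe starts with \<open>c_i\<close>. Next, \<open>i\<close>
    is written as \<open>i div k * k\<close> to fit \<open>sum_if_dvd\<close>.\<close>
  also have "\<dots> = (\<Sum>i<n. row_norm_sq ?S (n - Suc i))"
    by (rule sum.nat_diff_reindex[symmetric])
  also have "\<dots> = (\<Sum>i<n. (1 - (if i = 0 then 1 else 0)) + (if k dvd i then ?g (i div k * k) else 0))"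
  proof (rule sum.cong)
    fix i assume "i \<in> {..<n}"
    then have i: "i < n" by simp
    have "Suc (n - Suc i) = n - i" "n - Suc (n - Suc i) = i" using i by auto
    moreover have "k dvd n - i \<longleftrightarrow> k dvd i"
      using i n0(3) by (metis dvd_diffD1 dvd_diff_nat less_imp_le_nat)
    ultimately show "row_norm_sq ?S (n - Suc i) =
        (1 - (if i = 0 then 1 else 0)) + (if k dvd i then ?g (i div k * k) else 0)"
      using i by (subst row) auto
  qed simp
  also have "\<dots> = real n - 1 + (\<Sum>s<m + 1. ?g (s * k))"
    using n0 sum_if_dvd[OF k, of "\<lambda>s. ?g (s * k)" "m + 1"]
    by (simp add: sum.distrib sum_subtractf n(2) mult.commute[of k])
  also have "(\<Sum>s<m + 1. ?g (s * k)) = (\<Sum>i<n. (coeff p i)\<^sup>2)"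
  proof -
    have "?g (s * k) = (\<Sum>i=s*k..<s*k+k. (coeff p i)\<^sup>2)" for s
      using sum.shift_bounds_nat_ivl[of "\<lambda>i. (coeff p i)\<^sup>2" 0 "s * k" k]
      by (simp add: add.commute lessThan_atLeast0)
    then show ?thesis by (simp add: sum.nat_group n(2) mult.commute del: sum.lessThan_Suc mult_Suc mult_Suc_right)
  qed
  finally show ?thesis .
qed

text \<open>Besides the subdiagonal ones, only rows \<open>i\<close> with \<open>k dvd i\<close>
  contribute: with \<open>d = n - i\<close> they hold \<open>- c_d\<close> in the last column and
  \<open>c_(d+q) - c_d * c_q\<close> in column \<open>q - 1\<close> for \<open>0 < q < k\<close>.
  The values of \<open>d\<close> are \<open>t * k\<close> for
  \<open>1 \<le> t \<le> m + 1\<close>.\<close>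

lemma norm_sq_striped_inverse:
  assumes n: "degree p = n" "n = k * (m + 1)" and k: "k > 0" and m: "m > 0"
    and c: "lead_coeff p = 1"
  shows "norm_sq (striped_inverse p k) = real n + (\<Sum>i=1..k-1. (coeff p i)\<^sup>2) +
    (\<Sum>j=1..m. (coeff p (j * k))\<^sup>2 +
       (\<Sum>i=1..k-1. (coeff p i * coeff p (j * k) - coeff p (j * k + i))\<^sup>2))"
proof -
  let ?T = "striped_inverse p k"
  let ?u = "\<lambda>d i. (coeff p i * coeff p d - coeff p (d + i))\<^sup>2"
  let ?h = "\<lambda>t. (coeff p (t * k))\<^sup>2 + (\<Sum>i=1..k-1. ?u (t * k) i)"
  have kn: "k < n" "k dvd n" using n k m by auto
  have row: "row_norm_sq ?T i = (1 - (if i = 0 then 1 else 0)) +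
      (if k dvd i then ?h (m + 1 - i div k) else 0)" if i: "i < n" for i
  proof -
    let ?d = "n - i"
    have T: "?T $$ (i, j) = (if Suc j = i then 1 else 0) +
      (if k dvd i then (if Suc j < k then coeff p (?d + Suc j) else 0)
        - coeff p ?d * (if Suc j = n then 1 else if Suc j < k then coeff p (Suc j) else 0) else 0)"
      if "j < n" for j
      using i that n(1) by (simp add: striped_inverse_def)
    \<comment> \<open>No cross terms arise: a subdiagonal 1 in such a row has
      \<open>Suc j = i\<close>, with \<open>i \<ge> k\<close> and \<open>i < n\<close>, and
      \<open>k < n\<close> separates the other two parts.\<close>
    have sq: "(?T $$ (i, j))\<^sup>2 = (if Suc j = i then 1 else 0) + (if k dvd i then
        (if Suc j = n then (coeff p ?d)\<^sup>2 else 0) + (if Suc j < k then ?u ?d (Suc j) else 0) else 0)"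
      if "j < n" for j
    proof (cases "k dvd i")
      case True
      have "\<not> Suc j < k" if "Suc j = i" using True that by (auto dest: dvd_imp_le)
      then show ?thesis
        unfolding T[OF \<open>j < n\<close>] using i kn True by (auto simp: power2_commute mult.commute)
    next
      case False
      then show ?thesis by (simp add: T[OF \<open>j < n\<close>])
    qed
    have "row_norm_sq ?T i = (\<Sum>j<n. (?T $$ (i, j))\<^sup>2)"
      using carrier_matD(2)[OF striped_carrier(2)[OF n(1)]] by (simp add: row_norm_sq_def)
    also have "\<dots> = (\<Sum>j<n. (if Suc j = i then 1 else 0) + (if k dvd i then
        (if Suc j = n then (coeff p ?d)\<^sup>2 else 0) + (if Suc j < k then ?u ?d (Suc j) else 0) else 0))"
      using sq by (intro sum.cong) auto
    also have "\<dots> = (\<Sum>j<n. if Suc j = i then 1 else 0) + (if k dvd i then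
        (\<Sum>j<n. if Suc j = n then (coeff p ?d)\<^sup>2 else 0) + (\<Sum>i=1..k-1. ?u ?d i) else 0)"
      using sum_if_Suc_less[of k n "?u ?d"] kn by (auto simp: sum.distrib)
    also have "(\<Sum>j<n. if Suc j = i then 1 else 0 :: real) = 1 - (if i = 0 then 1 else 0)"
      using i by (cases i) auto
    also have "(\<Sum>j<n. if Suc j = n then (coeff p ?d)\<^sup>2 else 0) = (coeff p ?d)\<^sup>2"
      using kn by (cases n) auto
    also have "(if k dvd i then (coeff p ?d)\<^sup>2 + (\<Sum>i=1..k-1. ?u ?d i) else 0)
        = (if k dvd i then ?h (m + 1 - i div k) else 0)"
    proof -
      have "?d = (m + 1 - i div k) * k" if "k dvd i"
      proof -
        obtain s where "i = k * s" using \<open>k dvd i\<close> by blast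
        then show ?thesis using k n(2) by (simp only: diff_mult_distrib2 mult.commute[of _ k]
              nonzero_mult_div_cancel_left less_imp_neq not_less0 neq0_conv)
      qed
      then show ?thesis by auto
    qed
    finally show ?thesis .
  qed
  have "norm_sq ?T = (\<Sum>i<n. row_norm_sq ?T i)"
    using carrier_matD(1)[OF striped_carrier(2)[OF n(1)]] by (simp add: norm_sq_def)
  also have "\<dots> = (\<Sum>i<n. (1 - (if i = 0 then 1 else 0)) +
      (if k dvd i then ?h (m + 1 - i div k) else 0))"
    by (intro sum.cong) (simp_all only: row lessThan_iff)
  also have "\<dots> = real n - 1 + (\<Sum>i<n. if k dvd i then ?h (m + 1 - i div k) else 0)"
    using kn by (simp add: sum.distrib sum_subtractf)
  also have "(\<Sum>i<n. if k dvd i then ?h (m + 1 - i div k) else 0) = (\<Sum>s<m + 1. ?h (m + 1 - s))"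
    unfolding n(2) mult.commute[of k] by (rule sum_if_dvd[OF k])
  \<comment> \<open>The summand is put into the form that \<open>sum.nat_diff_reindex\<close>
    reverses.\<close>
  also have "\<dots> = (\<Sum>s<m + 1. ?h (Suc (m + 1 - Suc s)))"
    by (intro sum.cong) (auto simp: Suc_diff_le)
  also have "\<dots> = (\<Sum>s<m + 1. ?h (Suc s))"
    by (rule sum.nat_diff_reindex)
  also have "\<dots> = (\<Sum>t=1..m. ?h t) + ?h (m + 1)"
    by (simp add: sum.atLeast1_atMost_eq)
  \<comment> \<open>This is the top row, with \<open>d = n\<close>: here \<open>c_n = 1\<close> and
    all higher coefficients vanish.\<close>
  also have "?h (m + 1) = 1 + (\<Sum>i=1..k-1. (coeff p i)\<^sup>2)"
  proof -
    have nk: "(m + 1) * k = n" using n(2) by (simp add: mult.commute)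
    have "?u n i = (coeff p i)\<^sup>2" if "i \<in> {1..k-1}" for i
      using that c n(1) by (simp add: coeff_eq_0)
    then show ?thesis unfolding nk using c n(1) by simp
  qed
  finally show ?thesis by simp
qed

text \<open>Cuts the indices into blocks of length \<open>k\<close> and separates the first index of
  each later block, matching the terms of \<open>norm_sq_striped_inverse\<close>.\<close>

lemma sum_stripes:
  fixes f :: "nat \<Rightarrow> 'a :: comm_monoid_add"
  assumes n: "n = k * (m + 1)" and k: "k > 0"
  shows "(\<Sum>i=1..n-1. f i) = (\<Sum>i=1..k-1. f i) + (\<Sum>j=1..m. f (j * k) + (\<Sum>i=1..k-1. f (j * k + i)))"
proof -
  have block: "(\<Sum>i=j*k..<j*k+k. f i) = f (j * k) + (\<Sum>i=1..k-1. f (j * k + i))" for j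
  proof -
    have "(\<Sum>i=j*k..<j*k+k. f i) = (\<Sum>i<k. f (j * k + i))"
      using sum.shift_bounds_nat_ivl[of f 0 "j * k" k] by (simp add: add.commute lessThan_atLeast0)
    also have "\<dots> = (\<Sum>i<Suc (k - 1). f (j * k + i))" using k by simp
    also have "\<dots> = f (j * k) + (\<Sum>i=1..k-1. f (j * k + i))"
      by (simp add: sum.lessThan_Suc_shift sum.atLeast1_atMost_eq del: sum.lessThan_Suc)
    finally show ?thesis .
  qed
  \<comment> \<open>The first block is treated apart because it lacks the index 0.\<close>
  have "{1..n-1} = {1..<k} \<union> {k..<n}" "{1..<k} = {1..k-1}" using n k by auto
  then have "(\<Sum>i=1..n-1. f i) = (\<Sum>i=1..k-1. f i) + (\<Sum>i=k..<n. f i)"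
    by (metis (no_types, lifting) finite_atLeastLessThan ivl_disj_int_two(3) sum.union_disjoint)
  also have "(\<Sum>i=k..<n. f i) = (\<Sum>i<m * k. f (i + k))"
    using sum.shift_bounds_nat_ivl[of f 0 k "m * k"] n
    by (simp add: lessThan_atLeast0 algebra_simps)
  also have "\<dots> = (\<Sum>j<m. \<Sum>i=j*k..<j*k+k. f (i + k))"
    by (rule sum.nat_group[symmetric])
  also have "\<dots> = (\<Sum>j<m. \<Sum>i=Suc j*k..<Suc j*k+k. f i)"
  proof (rule sum.cong)
    fix j
    show "(\<Sum>i=j*k..<j*k+k. f (i + k)) = (\<Sum>i=Suc j*k..<Suc j*k+k. f i)"
      using sum.shift_bounds_nat_ivl[of f "j * k" k "j * k + k"] by (simp add: ac_simps)
  qed simp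
  also have "\<dots> = (\<Sum>j=1..m. f (j * k) + (\<Sum>i=1..k-1. f (j * k + i)))"
    by (simp only: block sum.atLeast1_atMost_eq One_nat_def)
  finally show ?thesis .
qed

section \<open>Comparison of the striped matrix with the Fiedler companion matrices\<close>

theorem theorem4p1:
  fixes p :: "real poly" and k m n :: nat
  assumes "k > 0" and "m > 0" and "n = k * (m + 1)"
    and "degree p = n" and "lead_coeff p = 1" and "coeff p 0 = 1"
  shows "(\<exists>S. striped_companion p (replicate (m + 1) k) S \<and>
            (\<forall>F. fiedler_companion p F \<longrightarrow> condition_number S \<le> condition_number F))
    \<longleftrightarrow>
         (\<Sum>j=1..m. \<Sum>i=1..k-1. \<bar>coeff p i * coeff p (j * k) - coeff p (j * k + i)\<bar>\<^sup>2)
       \<le> (\<Sum>j=1..m. \<Sum>i=1..k-1. \<bar>coeff p (j * k + i)\<bar>\<^sup>2)"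
proof -
  let ?S = "striped_matrix p (replicate (m + 1) k)" and ?T = "striped_inverse p k"
  define Q where "Q = real n + (\<Sum>i=1..n-1. (coeff p i)\<^sup>2)"
  have n: "n > 0" using assms by simp
  have Q: "Q > 0" unfolding Q_def using n by (simp add: add_pos_nonneg sum_nonneg)
  have F: "condition_number F = Q" if "fiedler_companion p F" for F
    using condition_number_fiedler[OF assms(6,4) n that] by (simp add: Q_def)
  have "striped_companion p (replicate (m + 1) k) S \<longleftrightarrow> S = ?S" for S
    using assms unfolding striped_companion_def by (auto simp: sum_list_replicate)
  \<comment> \<open>The stripe lengths determine \<open>S\<close>, and all Fiedler companion
    matrices share the condition number \<open>Q\<close>; as one exists, both quantifiers
    disappear.\<close>
  then have "(\<exists>S. striped_companion p (replicate (m + 1) k) S \<and>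
      (\<forall>F. fiedler_companion p F \<longrightarrow> condition_number S \<le> condition_number F))
      \<longleftrightarrow> condition_number ?S \<le> Q"
    using F fiedler_companion_exists[of p] by auto
  also have "condition_number ?S = sqrt (norm_sq ?S) * sqrt (norm_sq ?T)"
    using striped_carrier[OF assms(4)] striped_mult_inverse[OF assms(4,3,1,2,5,6)]
    by (intro condition_number_eq)
  also have "norm_sq ?S = Q"
  proof -
    have "{..<n} = insert 0 {1..n-1}" using n by auto
    then have "(\<Sum>i<n. (coeff p i)\<^sup>2) = 1 + (\<Sum>i=1..n-1. (coeff p i)\<^sup>2)"
      using assms(6) by simp
    then show ?thesis unfolding norm_sq_striped_matrix[OF assms(4,3,1)] Q_def by simp
  qed
  \<comment> \<open>Since \<open>Q > 0\<close>, one factor \<open>sqrt Q\<close> cancels and only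
    the norm of the inverse matters.\<close>
  also have "sqrt Q * sqrt (norm_sq ?T) \<le> Q \<longleftrightarrow> norm_sq ?T \<le> Q"
  proof -
    have "sqrt Q * sqrt (norm_sq ?T) \<le> Q \<longleftrightarrow> sqrt Q * sqrt (norm_sq ?T) \<le> sqrt Q * sqrt Q"
      using Q by simp
    also have "\<dots> \<longleftrightarrow> norm_sq ?T \<le> Q" using Q by (simp del: real_sqrt_mult_self)
    finally show ?thesis .
  qed
  \<comment> \<open>The terms \<open>n\<close>, the squares from \<open>c_1\<close> to
    \<open>c_(k-1)\<close> and the squares of the \<open>c_(j*k)\<close> occur on both sides and
    cancel.\<close>
  also have "\<dots> \<longleftrightarrow>
         (\<Sum>j=1..m. \<Sum>i=1..k-1. \<bar>coeff p i * coeff p (j * k) - coeff p (j * k + i)\<bar>\<^sup>2)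
       \<le> (\<Sum>j=1..m. \<Sum>i=1..k-1. \<bar>coeff p (j * k + i)\<bar>\<^sup>2)"
    unfolding Q_def norm_sq_striped_inverse[OF assms(4,3,1,2,5)]
      sum_stripes[OF assms(3,1), of "\<lambda>i. (coeff p i)\<^sup>2"]
    by (simp add: sum.distrib)
  finally show ?thesis .
qed

end
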